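(* Let $X$ and $P$ be metric spaces, let $\langle X,\varphi,(P,\mathbb{T},\theta)\rangle$ be a nonautonomous dynamical system, and let $\pi$ be its skew-product semiflow on $P\times X$. Let $U\subset P\times X$ be a pre-attractor for $\pi$ (with time $T$), and let $\mathcal{A}\subset P\times X$ be the local attractor for $\pi$ determined by $U$. For $p\in P$ put $U(p)=\{x\in X:(p,x)\in U\}$ and $$A(p)=\bigcap_{t\ge T}\overline{\bigcup_{s\ge t}\varphi(s,\theta_{-s}p,U(\theta_{-s}p))}.$$ Then $A=(A(p))_{p\in P}$ is the local attractor for $\varphi$ determined by the pre-attractor $(U(p))_{p\in P}$ of $\varphi$, and $$\bigcup_{p\in P}\{p\}\times A(p)\subset\mathcal{A},$$ where $\{p\}\times\emptyset=\emptyset$.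
   Context: $\mathbb{T}$ is $\mathbb{R}$ or $\mathbb{Z}$, and $\mathbb{T}^+$ is the set of its non-negative elements. $(X,d_X)$ (state space) and $P$ (base space) are metric spaces. Nonautonomous dynamical system (NDS) $\langle X,\varphi,(P,\mathbb{T},\theta)\rangle$: $\theta:\mathbb{T}\times P\to P$ is continuous, the maps $\theta_t=\theta(t,\cdot)$ are homeomorphisms of $P$ with $\theta_0=\mathrm{id}_P$, $\theta_{t+s}=\theta_t\circ\theta_s$ for all $t,s\in\mathbb{T}$; and $\varphi:\mathbb{T}^+\times P\times X\to X$ is continuous with $\varphi(0,p,x)=x$ and $\varphi(t+s,p,x)=\varphi(t,\theta_sp,\varphi(s,p,x))$ for all $t,s\in\mathbb{T}^+$, $(p,x)\in P\times X$. Write $\varphi(t,p)x=\varphi(t,p,x)$. The skew-product semiflow is $\pi:\mathbb{T}^+\times(P\times X)\to P\times X$, $\pi(t,(p,x))=(\theta_tp,\varphi(t,p,x))$. Pre-attractor and local attractor for $\pi$: an open set $U\subset P\times X$ is a pre-attractor for $\pi$ with time $T>0$ if $\overline{\bigcup_{s\ge T}\pi(s,U)}\subset U$; the local attractor for $\pi$ determined by $U$ is $\mathcal{A}=\bigcap_{n\in\mathbb{N}}\overline{\bigcup_{s\ge nT}\pi(s,U)}$. Pre-attractor and local attractor for $\varphi$: a family $(U(p))_{p\in P}$ of open subsets of $X$ is a pre-attractor for $\varphi$ if there is a function $\tau:P\to(0,\infty)$ with $\overline{\bigcup_{t\ge\tau(p)}\varphi(t,\theta_{-t}p)U(\theta_{-t}p)}\subset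 U(p)$ for all $p\in P$. The local attractor determined by it is $A(p)=\bigcap_{n\in\mathbb{N}}\overline{\bigcup_{s\ge n\tau(p)}\varphi(s,\theta_{-s}p)U(\theta_{-s}p)}$, $\mathbb{N}=\{1,2,\dots\}$; it may be empty or noncompact. *)

theory Defs
  imports "HOL-Analysis.Analysis"
begin

text \<open>
  The time set is represented as a subset of \<^typ>\<open>real\<close>, either all reals or the integers, with the
  subspace topology (discrete in the second case).  The maps below are total on \<^typ>\<open>real\<close>, but
  only their values at times in the time set (respectively its non-negative part) are constrained
  or used.
\<close>

definition nonneg_times :: "real set \<Rightarrow> real set" where
  "nonneg_times TT = {t \<in> TT. 0 \<le> t}"

locale nonautonomous_dynamical_system =
  fixes TT :: "real set"
    and \<theta> :: "real \<Rightarrow> 'p::metric_space \<Rightarrow> 'p"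
    and \<phi> :: "real \<Rightarrow> 'p \<Rightarrow> 'x::metric_space \<Rightarrow> 'x"
  assumes time_set: "TT = UNIV \<or> TT = \<int>"
    and base_continuous: "continuous_on (TT \<times> UNIV) (\<lambda>(t, p). \<theta> t p)"
    and base_homeomorphism: "\<And>t. t \<in> TT \<Longrightarrow> \<exists>g. homeomorphism UNIV UNIV (\<theta> t) g"
    and base_zero: "\<theta> 0 = id"
    and base_add: "\<And>t s. t \<in> TT \<Longrightarrow> s \<in> TT \<Longrightarrow> \<theta> (t + s) = \<theta> t \<circ> \<theta> s"
    and cocycle_continuous:
      "continuous_on (nonneg_times TT \<times> UNIV \<times> UNIV) (\<lambda>(t, p, x). \<phi> t p x)"
    and cocycle_zero: "\<And>p x. \<phi> 0 p x = x"
    and cocycle_add: "\<And>t s p x. t \<in> nonneg_times TT \<Longrightarrow> s \<in> nonneg_times TT \<Longrightarrow>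
      \<phi> (t + s) p x = \<phi> t (\<theta> s p) (\<phi> s p x)"

definition skew_product ::
  "(real \<Rightarrow> 'p \<Rightarrow> 'p) \<Rightarrow> (real \<Rightarrow> 'p \<Rightarrow> 'x \<Rightarrow> 'x) \<Rightarrow> real \<Rightarrow> 'p \<times> 'x \<Rightarrow> 'p \<times> 'x" where
  "skew_product \<theta> \<phi> t = (\<lambda>(p, x). (\<theta> t p, \<phi> t p x))"

definition semiflow_pre_attractor ::
  "real set \<Rightarrow> (real \<Rightarrow> 'z \<Rightarrow> 'z) \<Rightarrow> real \<Rightarrow> 'z::metric_space set \<Rightarrow> bool" where
  "semiflow_pre_attractor TT \<pi> T U \<longleftrightarrow>
     open U \<and> 0 < T \<and> closure (\<Union>s\<in>{s \<in> nonneg_times TT. T \<le> s}. \<pi> s ` U) \<subseteq> U"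

definition semiflow_local_attractor ::
  "real set \<Rightarrow> (real \<Rightarrow> 'z \<Rightarrow> 'z) \<Rightarrow> real \<Rightarrow> 'z::metric_space set \<Rightarrow> 'z set" where
  "semiflow_local_attractor TT \<pi> T U =
     (\<Inter>n\<in>{1::nat..}. closure (\<Union>s\<in>{s \<in> nonneg_times TT. real n * T \<le> s}. \<pi> s ` U))"

definition pullback_tail ::
  "real set \<Rightarrow> (real \<Rightarrow> 'p \<Rightarrow> 'p) \<Rightarrow> (real \<Rightarrow> 'p \<Rightarrow> 'x \<Rightarrow> 'x) \<Rightarrow> ('p \<Rightarrow> 'x set) \<Rightarrow> real \<Rightarrow> 'p
     \<Rightarrow> 'x set" where
  "pullback_tail TT \<theta> \<phi> V r p =
     (\<Union>s\<in>{s \<in> nonneg_times TT. r \<le> s}. \<phi> s (\<theta> (- s) p) ` V (\<theta> (- s) p))"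

definition pre_attractor_times ::
  "real set \<Rightarrow> (real \<Rightarrow> 'p \<Rightarrow> 'p) \<Rightarrow> (real \<Rightarrow> 'p \<Rightarrow> 'x::metric_space \<Rightarrow> 'x) \<Rightarrow> ('p \<Rightarrow> 'x set)
     \<Rightarrow> ('p \<Rightarrow> real) \<Rightarrow> bool" where
  "pre_attractor_times TT \<theta> \<phi> V \<tau> \<longleftrightarrow>
     (\<forall>p. 0 < \<tau> p \<and> closure (pullback_tail TT \<theta> \<phi> V (\<tau> p) p) \<subseteq> V p)"

definition cocycle_pre_attractor ::
  "real set \<Rightarrow> (real \<Rightarrow> 'p \<Rightarrow> 'p) \<Rightarrow> (real \<Rightarrow> 'p \<Rightarrow> 'x::metric_space \<Rightarrow> 'x) \<Rightarrow> ('p \<Rightarrow> 'x set)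
     \<Rightarrow> bool" where
  "cocycle_pre_attractor TT \<theta> \<phi> V \<longleftrightarrow>
     (\<forall>p. open (V p)) \<and> (\<exists>\<tau>. pre_attractor_times TT \<theta> \<phi> V \<tau>)"

definition cocycle_local_attractor ::
  "real set \<Rightarrow> (real \<Rightarrow> 'p \<Rightarrow> 'p) \<Rightarrow> (real \<Rightarrow> 'p \<Rightarrow> 'x::metric_space \<Rightarrow> 'x) \<Rightarrow> ('p \<Rightarrow> 'x set)
     \<Rightarrow> ('p \<Rightarrow> real) \<Rightarrow> 'p \<Rightarrow> 'x set" where
  "cocycle_local_attractor TT \<theta> \<phi> V \<tau> p =
     (\<Inter>n\<in>{1::nat..}. closure (pullback_tail TT \<theta> \<phi> V (real n * \<tau> p) p))"

text \<open>
  The local attractor of a pre-attractor is written with a time function \<open>\<tau>\<close> that the family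
  \<open>V\<close> does not determine.  We read ``\<open>A\<close> is the local attractor determined by \<open>V\<close>'' as: \<open>V\<close> is
  a pre-attractor and \<open>A\<close> is given by the formula for every admissible \<open>\<tau>\<close>.
\<close>

definition is_cocycle_local_attractor ::
  "real set \<Rightarrow> (real \<Rightarrow> 'p \<Rightarrow> 'p) \<Rightarrow> (real \<Rightarrow> 'p \<Rightarrow> 'x::metric_space \<Rightarrow> 'x) \<Rightarrow> ('p \<Rightarrow> 'x set)
     \<Rightarrow> ('p \<Rightarrow> 'x set) \<Rightarrow> bool" where
  "is_cocycle_local_attractor TT \<theta> \<phi> V A \<longleftrightarrow>
     cocycle_pre_attractor TT \<theta> \<phi> V \<and>
     (\<forall>\<tau>. pre_attractor_times TT \<theta> \<phi> V \<tau> \<longrightarrow> A = cocycle_local_attractor TT \<theta> \<phi> V \<tau>)"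

end

theory Submission
  imports Defs
begin

text \<open>
  Since \<open>\<theta> s (\<theta> (- s) p) = p\<close>, the slice \<open>{p} \<times> pullback_tail r p\<close> lies in the forward tail
  \<open>\<Union>s\<ge>r. \<pi> s ` U\<close>, and taking closures preserves this.  With \<open>r = T\<close> this makes the fibres a
  pre-attractor with constant time \<open>T\<close>; with \<open>r = n T\<close> it gives the inclusion of attractors.
  The pullback tails decrease in \<open>r\<close>, so intersecting their closures over any set of times that is
  unbounded above gives the same set, whichever time function is used.
\<close>

text \<open>Each member of either family contains a member of the other one, because a larger index
  gives a smaller set. This will compare real times \<open>t\<close> with the multiples of
  \<open>\<tau> p\<close>.\<close>

lemma INT_antimono_cofinal:
  fixes F :: "'a::order \<Rightarrow> 'b set"
  assumes "antimono F"
    and "\<And>i. i \<in> I \<Longrightarrow> \<exists>j\<in>J. f i \<le> g j" and "\<And>j. j \<in> J \<Longrightarrow> \<exists>i\<in>I. g j \<le> f i"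
  shows "(\<Inter>i\<in>I. F (f i)) = (\<Inter>j\<in>J. F (g j))"
proof (intro equalityI INT_greatest)
  show "(\<Inter>i\<in>I. F (f i)) \<subseteq> F (g j)" if "j \<in> J" for j
    using assms(3)[OF that] antimonoD[OF assms(1)] by blast
  show "(\<Inter>j\<in>J. F (g j)) \<subseteq> F (f i)" if "i \<in> I" for i
    using assms(2)[OF that] antimonoD[OF assms(1)] by blast
qed

lemma open_Pair_fibre:
  assumes "open U"
  shows "open {x. (p, x) \<in> U}"
  using open_vimage[OF assms, of "Pair p"] by (simp add: vimage_def continuous_intros)

text \<open>\<open>Pair p\<close> is continuous and \<open>closure R\<close> is closed, so the
  inclusion survives passing to limits.\<close>

lemma Pair_closure_subset:
  assumes "Pair p ` S \<subseteq> closure R"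
  shows "Pair p ` closure S \<subseteq> closure R"
  using assms by (intro image_closure_subset) (auto intro: continuous_intros)

lemma closure_pullback_tail_antimono:
  "antimono (\<lambda>r. closure (pullback_tail TT \<theta> \<phi> V r p))"
  by (intro antimonoI closure_mono) (fastforce simp: pullback_tail_def)

context nonautonomous_dynamical_system
begin

lemma times_unbounded: "\<exists>t\<in>TT. r \<le> t"
  using time_set by (metis Ints_of_int UNIV_I le_of_int_ceiling)

text \<open>Both time sets are closed under negation, so \<open>base_add\<close> applies to
  \<open>s\<close> and \<open>- s\<close>, whose sum acts as the identity.\<close>

lemma base_right_inverse:
  assumes "s \<in> TT"
  shows "\<theta> s (\<theta> (- s) p) = p"
proof -
  have "- s \<in> TT"
    using time_set assms by auto
  from base_add[OF assms this] show ?thesis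
    by (simp add: base_zero fun_eq_iff)
qed

lemma Pair_pullback_tail_subset:
  "Pair p ` pullback_tail TT \<theta> \<phi> (\<lambda>q. {x. (q, x) \<in> U}) r p
    \<subseteq> (\<Union>s\<in>{s \<in> nonneg_times TT. r \<le> s}. skew_product \<theta> \<phi> s ` U)"
proof -
  have "(p, \<phi> s (\<theta> (- s) p) x) \<in> skew_product \<theta> \<phi> s ` U"
    if "s \<in> nonneg_times TT" "(\<theta> (- s) p, x) \<in> U" for s x
    \<comment> \<open>The preimage is the pullback starting point over
      \<open>\<theta> (- s) p\<close>; time \<open>s\<close> carries its base component back to
      \<open>p\<close>.\<close>
    using that base_right_inverse[of s p]
    by (intro image_eqI[where x = "(\<theta> (- s) p, x)"]) (auto simp: skew_product_def nonneg_times_def)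
  then show ?thesis
    by (fastforce simp: pullback_tail_def)
qed

lemma Pair_closure_pullback_tail_subset:
  "Pair p ` closure (pullback_tail TT \<theta> \<phi> (\<lambda>q. {x. (q, x) \<in> U}) r p)
    \<subseteq> closure (\<Union>s\<in>{s \<in> nonneg_times TT. r \<le> s}. skew_product \<theta> \<phi> s ` U)"
  by (intro Pair_closure_subset order_trans[OF Pair_pullback_tail_subset closure_subset])

lemma pre_attractor_times_fibres:
  assumes "semiflow_pre_attractor TT (skew_product \<theta> \<phi>) T U"
  shows "pre_attractor_times TT \<theta> \<phi> (\<lambda>p. {x. (p, x) \<in> U}) (\<lambda>_. T)"
  using assms Pair_closure_pullback_tail_subset[where U = U and r = T]
  unfolding semiflow_pre_attractor_def pre_attractor_times_def by blast

text \<open>The left side does not mention \<open>\<tau>\<close>, so the attractor is the same for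
  every admissible time function.\<close>

lemma INT_times_closure_pullback_tail:
  assumes "0 < \<tau> p"
  shows "(\<Inter>t\<in>{t \<in> TT. T \<le> t}. closure (pullback_tail TT \<theta> \<phi> V t p))
    = cocycle_local_attractor TT \<theta> \<phi> V \<tau> p"
  unfolding cocycle_local_attractor_def
proof (rule INT_antimono_cofinal[OF closure_pullback_tail_antimono])
  fix t :: real
  obtain n where "t < real n * \<tau> p"
    using reals_Archimedean3[OF assms] by blast
  \<comment> \<open>The Archimedean \<open>n\<close> may be 0, while the indices start at 1.\<close>
  also have "\<dots> \<le> real (Suc n) * \<tau> p"
    using assms by simp
  finally show "\<exists>n\<in>{1::nat..}. t \<le> real n * \<tau> p"
    by (intro bexI[of _ "Suc n"]) auto
next
  fix n :: nat
  show "\<exists>t\<in>{t \<in> TT. T \<le> t}. real n * \<tau> p \<le> t"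
    using times_unbounded[of "max T (real n * \<tau> p)"] by auto
qed

lemma Pair_cocycle_local_attractor_subset:
  "Pair p ` cocycle_local_attractor TT \<theta> \<phi> (\<lambda>q. {x. (q, x) \<in> U}) (\<lambda>_. T) p
    \<subseteq> semiflow_local_attractor TT (skew_product \<theta> \<phi>) T U"
  unfolding cocycle_local_attractor_def semiflow_local_attractor_def
  using Pair_closure_pullback_tail_subset by fast

end

theorem lemma3p7:
  fixes TT :: "real set"
    and \<theta> :: "real \<Rightarrow> 'p::metric_space \<Rightarrow> 'p"
    and \<phi> :: "real \<Rightarrow> 'p \<Rightarrow> 'x::metric_space \<Rightarrow> 'x"
    and U :: "('p \<times> 'x) set"
    and T :: real
    and Ufib A :: "'p \<Rightarrow> 'x set"
  assumes "nonautonomous_dynamical_system TT \<theta> \<phi>"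
    and "semiflow_pre_attractor TT (skew_product \<theta> \<phi>) T U"
    and "\<And>p. Ufib p = {x. (p, x) \<in> U}"
    and "\<And>p. A p = (\<Inter>t\<in>{t \<in> TT. T \<le> t}.
           closure (\<Union>s\<in>{s \<in> TT. t \<le> s}. \<phi> s (\<theta> (- s) p) ` Ufib (\<theta> (- s) p)))"
  shows "cocycle_pre_attractor TT \<theta> \<phi> Ufib
    \<and> is_cocycle_local_attractor TT \<theta> \<phi> Ufib A
    \<and> (\<Union>p. {p} \<times> A p) \<subseteq> semiflow_local_attractor TT (skew_product \<theta> \<phi>) T U"
proof -
  interpret nonautonomous_dynamical_system TT \<theta> \<phi>
    by fact
  have Ufib: "Ufib = (\<lambda>p. {x. (p, x) \<in> U})"
    using assms(3) by blast
  have "open U" "0 < T"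
    using assms(2) by (auto simp: semiflow_pre_attractor_def)
  have pre: "cocycle_pre_attractor TT \<theta> \<phi> Ufib"
    unfolding cocycle_pre_attractor_def Ufib
    using open_Pair_fibre[OF \<open>open U\<close>] pre_attractor_times_fibres[OF assms(2)] by blast
  have "A p = (\<Inter>t\<in>{t \<in> TT. T \<le> t}. closure (pullback_tail TT \<theta> \<phi> Ufib t p))" for p
  proof -
    \<comment> \<open>Times beyond \<open>t\<close> are automatically non-negative, since
      \<open>t \<ge> T > 0\<close>.\<close>
    have "{s \<in> TT. t \<le> s} = {s \<in> nonneg_times TT. t \<le> s}" if "T \<le> t" for t
      using that \<open>0 < T\<close> by (auto simp: nonneg_times_def)
    then show ?thesis
      unfolding assms(4) pullback_tail_def by (intro INF_cong) auto
  qed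
  then have A: "A p = cocycle_local_attractor TT \<theta> \<phi> Ufib \<tau> p" if "0 < \<tau> p" for \<tau> p
    using INT_times_closure_pullback_tail[where \<tau> = \<tau>, OF that] by (rule trans)
  have "is_cocycle_local_attractor TT \<theta> \<phi> Ufib A"
    using pre A by (auto simp: is_cocycle_local_attractor_def pre_attractor_times_def)
  moreover have "(\<Union>p. {p} \<times> A p) \<subseteq> semiflow_local_attractor TT (skew_product \<theta> \<phi>) T U"
    \<comment> \<open>The constant time function \<open>T\<close> gives \<open>A\<close> the same
      thresholds \<open>n T\<close> as the semiflow attractor.\<close>
    using Pair_cocycle_local_attractor_subset \<open>0 < T\<close>
    by (fastforce simp: A[of "\<lambda>_. T"] Ufib)
  ultimately show ?thesis
    using pre by blast
qed

end
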